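(* Let $n\ge 2$ be an integer and let $G=\Gamma(\mathbb{Z}_n)$ be the co-maximal graph of $\mathbb{Z}_n$. (i) If $n=\prod_{i=1}^{k}p_i$ is a product of $k\ge 2$ distinct primes, then $$D(G,x)=(1+x)^{n}-(1+x)^{n-\phi(n)}+x\,D(G_2,x),$$ where $G_2$ is the subgraph of $G$ induced on the nonzero non-units of $\mathbb{Z}_n$. (ii) If $n=p_1^{n_1}p_2^{n_2}\cdots p_k^{n_k}$ is the canonical prime factorization of $n$ (distinct primes $p_i$, positive integers $n_i$), then $$D(G,x)=(1+x)^{n}-(1+x)^{n-\phi(n)}+x^{\overline{n}}\,D(G_2,x),$$ where $\overline{n}=\frac{n}{\prod_{i=1}^{k}p_i}$ and $G_2$ is the subgraph of $G$ induced on the set of those non-units of $\mathbb{Z}_n$ that are not multiples of $p_1p_2\cdots p_k$ (with $D(G_2,x)=1$ if this set is empty).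
   Context: All graphs are finite, simple and undirected. The co-maximal graph $\Gamma(\mathbb{Z}_n)$ has vertex set $\mathbb{Z}_n$, and two distinct elements $a,b$ are adjacent if and only if $a\mathbb{Z}_n+b\mathbb{Z}_n=\mathbb{Z}_n$. A dominating set of a graph $G$ is a non-empty set $S\subseteq V(G)$ such that every vertex of $V(G)\setminus S$ is adjacent to at least one vertex of $S$. The domination polynomial of $G$ is $D(G,x)=\sum_{k} D(G,k)x^k$, where $D(G,k)$ is the number of dominating sets of $G$ of cardinality $k$. The graph with no vertices is given domination polynomial $1$. $\phi$ is Euler's totient function. *)

theory Defs
  imports
    "HOL-Number_Theory.Number_Theory"
    "HOL-Computational_Algebra.Polynomial"
    "Graph_Theory.Graph_Theory"
begin

definition comaximal_graph :: "('a, 'm) ring_scheme \<Rightarrow> ('a, 'a \<times> 'a) pre_digraph" where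
  "comaximal_graph R = with_proj
     \<lparr> pverts = carrier R,
       parcs = {(a, b). a \<in> carrier R \<and> b \<in> carrier R \<and> a \<noteq> b \<and>
                 (PIdl\<^bsub>R\<^esub> a) <+>\<^bsub>R\<^esub> (PIdl\<^bsub>R\<^esub> b) = carrier R} \<rparr>"

text \<open>As in the AFP entry on graph theory, a finite simple undirected graph is a
  finite loop-free symmetric digraph without parallel arcs (locale \<^locale>\<open>graph\<close>).\<close>

lemma (in cring) graph_comaximal_graph:
  assumes "finite (carrier R)"
  shows "graph (comaximal_graph R)"
proof -
  let ?H = "\<lparr> pverts = carrier R,
       parcs = {(a, b). a \<in> carrier R \<and> b \<in> carrier R \<and> a \<noteq> b \<and>
                 (PIdl\<^bsub>R\<^esub> a) <+>\<^bsub>R\<^esub> (PIdl\<^bsub>R\<^esub> b) = carrier R} \<rparr>"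
  have fin: "finite (parcs ?H)"
    by (rule finite_subset[of _ "carrier R \<times> carrier R"]) (auto simp: assms)
  have comm: "(PIdl\<^bsub>R\<^esub> a) <+>\<^bsub>R\<^esub> (PIdl\<^bsub>R\<^esub> b) = (PIdl\<^bsub>R\<^esub> b) <+>\<^bsub>R\<^esub> (PIdl\<^bsub>R\<^esub> a)"
    if "a \<in> carrier R" "b \<in> carrier R" for a b
    using that cgenideal_ideal
    by (intro set_add_comm) (auto simp: cgenideal_def)
  have "pair_graph ?H"
    using fin assms comm
    by unfold_locales (auto simp: symmetric_def sym_def)
  then show ?thesis
    unfolding comaximal_graph_def by (rule pair_graph.pair_graphD_graph)
qed

lemma graph_comaximal_graph_residue_ring:
  assumes "n \<ge> (2::nat)"
  shows "graph (comaximal_graph (residue_ring (int n)))"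
proof -
  interpret residues "int n" "residue_ring (int n)"
    using assms by unfold_locales auto
  show ?thesis
    by (rule graph_comaximal_graph) (rule finite)
qed

definition dominating_set :: "('a, 'b) pre_digraph \<Rightarrow> 'a set \<Rightarrow> bool" where
  "dominating_set G S \<longleftrightarrow> S \<noteq> {} \<and> S \<subseteq> verts G \<and>
     (\<forall>v \<in> verts G - S. \<exists>u \<in> S. v \<rightarrow>\<^bsub>G\<^esub> u)"

definition num_dominating_sets :: "('a, 'b) pre_digraph \<Rightarrow> nat \<Rightarrow> nat" where
  "num_dominating_sets G k = card {S. dominating_set G S \<and> card S = k}"

text \<open>The graph without vertices has no dominating set (these are non-empty), so its
  polynomial is set to 1 by convention.\<close>

definition domination_poly :: "('a, 'b) pre_digraph \<Rightarrow> int poly" where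
  "domination_poly G =
     (if verts G = {} then 1
      else \<Sum>k \<le> card (verts G). Polynomial.monom (int (num_dominating_sets G k)) k)"

end

theory Submission
  imports Defs
begin

text \<open>
  The units of \<open>\<int>\<^sub>n\<close> are universal vertices of the co-maximal graph: a unit generates the whole
  ring.  Hence every set that contains a unit is dominating, and these sets are counted by
  \<open>(1 + x) ^ n - (1 + x) ^ (n - \<phi>(n))\<close>, the enumerator of all subsets minus that of the
  sets of non-units.

  It remains to count the dominating sets \<open>S\<close> without units.  Let \<open>J\<close> be the set of the multiples
  of \<open>p\<^sub>1 \<cdots> p\<^sub>k\<close>, that is, the Jacobson radical.  An element of \<open>J\<close> is divisible by every prime
  factor of \<open>n\<close>, and a non-unit by at least one, so the two have a common prime factor with \<open>n\<close>
  and are not adjacent.  No non-unit can therefore dominate an element of \<open>J\<close>, which forces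
  \<open>J \<subseteq> S\<close>, and the elements of \<open>J\<close> dominate no other non-unit, so that \<open>S - J\<close> has to dominate
  the remaining non-units by itself.  Conversely, \<open>J\<close> together with such a set dominates the
  units too, because \<open>J\<close> contains \<open>0\<close> and is thus not empty.  As \<open>J\<close> has \<open>n / (p\<^sub>1 \<cdots> p\<^sub>k)\<close>
  elements, these sets contribute the last summand.

  The graph-theoretic half of this argument, lemma \<open>domination_poly_universal_isolated\<close>, only uses
  how the three vertex classes are joined.  For squarefree \<open>n\<close> the radical is \<open>{0}\<close>, so the first
  formula is an instance of the second.
\<close>

section \<open>Domination polynomials as set enumerators\<close>

text \<open>Dropping the requirement that a dominating set is non-empty has no effect on graphs with
  vertices, and makes \<open>{}\<close> dominate the graph without vertices.  The enumerator of this family is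
  thus the domination polynomial in all cases, including its convention for the empty graph.\<close>

definition dominating_family :: "('a, 'b) pre_digraph \<Rightarrow> 'a set set" where
  "dominating_family G = {S. S \<subseteq> verts G \<and> (\<forall>v \<in> verts G - S. \<exists>u \<in> S. v \<rightarrow>\<^bsub>G\<^esub> u)}"

lemma dominating_family_eq:
  assumes "verts G \<noteq> {}"
  shows "dominating_family G = {S. dominating_set G S}"
  using assms by (auto simp: dominating_family_def dominating_set_def)

lemma finite_dominating_family:
  assumes "finite (verts G)"
  shows "finite (dominating_family G)"
  by (rule finite_subset[of _ "Pow (verts G)"]) (use assms in \<open>auto simp: dominating_family_def\<close>)

definition size_enumerator :: "'a set set \<Rightarrow> int poly" where
  "size_enumerator F = (\<Sum>S\<in>F. [:0, 1:] ^ card S)"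

lemma size_enumerator_Un:
  assumes "finite F" "finite F'" "F \<inter> F' = {}"
  shows "size_enumerator (F \<union> F') = size_enumerator F + size_enumerator F'"
  using assms by (simp add: size_enumerator_def sum.union_disjoint)

lemma size_enumerator_Pow:
  assumes "finite A"
  shows "size_enumerator (Pow A) = [:1, 1:] ^ card A"
proof -
  have "[:1, 1:] ^ card A = (\<Prod>a\<in>A. [:0, 1:] + (1 :: int poly))"
    by (simp add: one_pCons)
  also have "\<dots> = size_enumerator (Pow A)"
    by (subst prod_add[OF assms]) (simp add: size_enumerator_def)
  finally show ?thesis ..
qed

lemma size_enumerator_Un_image:
  assumes "finite J" and "\<And>S. S \<in> F \<Longrightarrow> finite S \<and> J \<inter> S = {}"
  shows "size_enumerator ((\<union>) J ` F) = [:0, 1:] ^ card J * size_enumerator F"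
proof -
  have "inj_on ((\<union>) J) F"
    using assms(2) by (intro inj_onI) blast
  then have "size_enumerator ((\<union>) J ` F) = (\<Sum>S\<in>F. [:0, 1:] ^ card (J \<union> S))"
    by (simp add: size_enumerator_def sum.reindex)
  also have "\<dots> = (\<Sum>S\<in>F. [:0, 1:] ^ card J * [:0, 1:] ^ card S)"
    using assms by (intro sum.cong) (simp_all add: card_Un_disjoint power_add)
  finally show ?thesis
    by (simp add: size_enumerator_def sum_distrib_left)
qed

lemma domination_poly_eq_size_enumerator:
  assumes "finite (verts G)"
  shows "domination_poly G = size_enumerator (dominating_family G)"
proof (cases "verts G = {}")
  case True
  then have "dominating_family G = {{}}"
    by (auto simp: dominating_family_def)
  with True show ?thesis
    by (simp add: domination_poly_def size_enumerator_def)
next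
  case False
  let ?F = "dominating_family G"
  have "card ` ?F \<subseteq> {..card (verts G)}"
    using assms by (auto simp: dominating_family_def intro: card_mono)
  then have "size_enumerator ?F =
      (\<Sum>k\<le>card (verts G). \<Sum>S\<in>{S \<in> ?F. card S = k}. [:0, 1:] ^ card S)"
    unfolding size_enumerator_def
    by (intro sum.group[symmetric] finite_dominating_family assms) auto
  also have "\<dots> = (\<Sum>k\<le>card (verts G). Polynomial.monom (int (num_dominating_sets G k)) k)"
    using False
    by (intro sum.cong)
      (simp_all add: num_dominating_sets_def dominating_family_eq monom_altdef of_nat_poly)
  finally show ?thesis
    using False by (simp add: domination_poly_def)
qed

section \<open>Graphs with universal vertices\<close>

lemma dominates_induce_subgraph_iff:
  "v \<rightarrow>\<^bsub>G \<restriction> X\<^esub> u \<longleftrightarrow> v \<in> X \<and> u \<in> X \<and> v \<rightarrow>\<^bsub>G\<^esub> u"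
  by (auto simp: arcs_ends_conv)

text \<open>Here \<open>U\<close> consists of universal vertices, and the vertices in \<open>J\<close> become isolated when \<open>U\<close> is
  removed.  A dominating set that avoids \<open>U\<close> contains all of \<open>J\<close> and is determined by its trace on
  \<open>M\<close>.  That \<open>J\<close> is not empty guarantees that such a set dominates \<open>U\<close>, even if the trace is
  empty.\<close>

lemma (in graph) domination_poly_universal_isolated:
  assumes verts: "verts G = U \<union> J \<union> M"
    and disj: "U \<inter> J = {}" "U \<inter> M = {}" "J \<inter> M = {}"
    and "J \<noteq> {}"
    and universal: "\<And>u v. u \<in> U \<Longrightarrow> v \<in> verts G \<Longrightarrow> u \<noteq> v \<Longrightarrow> u \<rightarrow> v"
    and isolated: "\<And>a b. a \<in> J \<Longrightarrow> b \<in> J \<union> M \<Longrightarrow> \<not> a \<rightarrow> b"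
  shows "domination_poly G =
    [:1, 1:] ^ card (verts G) - [:1, 1:] ^ (card (verts G) - card U)
      + [:0, 1:] ^ card J * domination_poly (G \<restriction> M)"
proof -
  let ?W = "J \<union> M"
  let ?V = "verts G"
  have fin: "finite ?V" "finite U" "finite J" "finite M"
    using finite_verts verts by auto
  have sym: "v \<rightarrow> u" if "u \<rightarrow> v" for u v
    using that by (rule graph_symmetric)
  have trace: "dominating_family G = (Pow ?V - Pow ?W) \<union> (\<union>) J ` dominating_family (G \<restriction> M)"
  proof (intro equalityI subsetI)
    fix S assume S: "S \<in> dominating_family G"
    show "S \<in> (Pow ?V - Pow ?W) \<union> (\<union>) J ` dominating_family (G \<restriction> M)"
    proof (cases "S \<subseteq> ?W")
      case False
      with S show ?thesis by (auto simp: dominating_family_def)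
    next
      case True
      have "J \<subseteq> S"
      proof
        fix a assume "a \<in> J"
        show "a \<in> S"
        proof (rule ccontr)
          assume "a \<notin> S"
          with S \<open>a \<in> J\<close> obtain u where "u \<in> S" "a \<rightarrow> u"
            by (auto simp: dominating_family_def verts)
          with True isolated[OF \<open>a \<in> J\<close>] show False by blast
        qed
      qed
      have "\<exists>u \<in> S \<inter> M. v \<rightarrow> u" if v: "v \<in> M - S" for v
      proof -
        obtain u where "u \<in> S" "v \<rightarrow> u"
          using S v by (auto simp: dominating_family_def verts)
        moreover from this have "u \<notin> J"
          using isolated sym v by blast
        ultimately show ?thesis
          using True by blast
      qed
      then have "S \<inter> M \<in> dominating_family (G \<restriction> M)"
        by (auto simp: dominating_family_def dominates_induce_subgraph_iff)
      moreover have "S = J \<union> (S \<inter> M)"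
        using True \<open>J \<subseteq> S\<close> by blast
      ultimately show ?thesis by blast
    qed
  next
    fix S assume "S \<in> (Pow ?V - Pow ?W) \<union> (\<union>) J ` dominating_family (G \<restriction> M)"
    then consider u where "S \<subseteq> ?V" "u \<in> S" "u \<in> U"
      | T where "S = J \<union> T" "T \<in> dominating_family (G \<restriction> M)"
      using verts by blast
    then show "S \<in> dominating_family G"
    proof cases
      case 1
      with universal sym show ?thesis
        by (fastforce simp: dominating_family_def)
    next
      case 2
      obtain a where a: "a \<in> J" using \<open>J \<noteq> {}\<close> by blast
      have "\<exists>u\<in>S. v \<rightarrow> u" if v: "v \<in> ?V - S" for v
      proof (cases "v \<in> U")
        case True
        with universal a v 2 verts show ?thesis by blast
      next
        case False
        with v 2 show ?thesis
          by (auto simp: verts dominating_family_def dominates_induce_subgraph_iff)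
      qed
      with 2 verts show ?thesis
        by (auto simp: dominating_family_def)
    qed
  qed
  have "Pow ?V = (Pow ?V - Pow ?W) \<union> Pow ?W"
    using verts by blast
  then have "size_enumerator (Pow ?V) =
      size_enumerator (Pow ?V - Pow ?W) + size_enumerator (Pow ?W)"
    using size_enumerator_Un[of "Pow ?V - Pow ?W" "Pow ?W"] fin by auto
  moreover have "card ?W = card ?V - card U"
  proof -
    have "?W = ?V - U" using verts disj by blast
    then show ?thesis using fin(2) verts card_Diff_subset[of U ?V] by auto
  qed
  ultimately have with_unit: "size_enumerator (Pow ?V - Pow ?W) =
      [:1, 1:] ^ card ?V - [:1, 1:] ^ (card ?V - card U)"
    using fin by (simp add: size_enumerator_Pow algebra_simps)
  have sub: "S \<subseteq> M" if "S \<in> dominating_family (G \<restriction> M)" for S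
    using that by (simp add: dominating_family_def)
  have "domination_poly G = size_enumerator (Pow ?V - Pow ?W)
      + size_enumerator ((\<union>) J ` dominating_family (G \<restriction> M))"
    unfolding domination_poly_eq_size_enumerator[OF fin(1)] trace
    using fin sub by (intro size_enumerator_Un) (auto intro!: finite_dominating_family)
  also have "size_enumerator ((\<union>) J ` dominating_family (G \<restriction> M)) =
      [:0, 1:] ^ card J * domination_poly (G \<restriction> M)"
  proof (subst size_enumerator_Un_image)
    show "finite S \<and> J \<inter> S = {}" if "S \<in> dominating_family (G \<restriction> M)" for S
      using sub[OF that] fin(4) disj(3) by (auto dest: finite_subset)
  qed (use fin in \<open>simp_all add: domination_poly_eq_size_enumerator\<close>)
  finally show ?thesis
    by (simp add: with_unit)
qed

section \<open>The co-maximal graph of the integers modulo m\<close>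

lemma dominates_comaximal_graph_iff:
  "a \<rightarrow>\<^bsub>comaximal_graph R\<^esub> b \<longleftrightarrow> a \<in> carrier R \<and> b \<in> carrier R \<and> a \<noteq> b \<and>
     (PIdl\<^bsub>R\<^esub> a) <+>\<^bsub>R\<^esub> (PIdl\<^bsub>R\<^esub> b) = carrier R"
  by (simp add: comaximal_graph_def)

lemma (in cring) comaximal_graph_unit_universal:
  assumes "u \<in> Units R" "a \<in> carrier R" "u \<noteq> a"
  shows "u \<rightarrow>\<^bsub>comaximal_graph R\<^esub> a"
proof -
  have u: "u \<in> carrier R" using assms(1) by (rule Units_closed)
  have sub: "PIdl u \<subseteq> carrier R" "PIdl a \<subseteq> carrier R"
    using u assms(2) by (auto simp: cgenideal_def)
  have "(PIdl u) <+> (PIdl a) = carrier R"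
  proof
    show "(PIdl u) <+> (PIdl a) \<subseteq> carrier R"
      using sub by (rule set_add_closed)
    show "carrier R \<subseteq> (PIdl u) <+> (PIdl a)"
    proof
      fix x assume x: "x \<in> carrier R"
      \<comment> \<open>\<open>x = (x u\<^sup>-\<^sup>1) u + 0 a\<close>\<close>
      have "x = (x \<otimes> inv u) \<otimes> u \<oplus> \<zero> \<otimes> a"
        using x u assms by (simp add: m_assoc)
      moreover have "(x \<otimes> inv u) \<otimes> u \<in> PIdl u" "\<zero> \<otimes> a \<in> PIdl a"
        using x assms(1) unfolding cgenideal_def by blast+
      ultimately show "x \<in> (PIdl u) <+> (PIdl a)"
        unfolding set_add_def' by blast
    qed
  qed
  with u assms show ?thesis
    by (simp add: dominates_comaximal_graph_iff)
qed

context residues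
begin

text \<open>A common divisor of \<open>a\<close>, \<open>b\<close> and \<open>m\<close> divides every element of \<open>(a) + (b)\<close>, since reduction
  modulo \<open>m\<close> preserves divisibility by it.  If it is prime, then \<open>1\<close> is not in that ideal.\<close>

lemma comaximal_graph_common_prime:
  assumes "prime q" "q dvd m" "q dvd a" "q dvd b"
  shows "\<not> a \<rightarrow>\<^bsub>comaximal_graph R\<^esub> b"
proof
  assume "a \<rightarrow>\<^bsub>comaximal_graph R\<^esub> b"
  then have "\<one> \<in> (PIdl a) <+> (PIdl b)"
    by (simp add: dominates_comaximal_graph_iff)
  then obtain x y where "\<one> = x \<otimes> a \<oplus> y \<otimes> b"
    unfolding set_add_def' cgenideal_def by blast
  then have "1 = ((x * a) mod m + (y * b) mod m) mod m"
    by (simp add: res_one_eq res_add_eq res_mult_eq)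
  moreover have "q dvd ((x * a) mod m + (y * b) mod m) mod m"
    using assms(2-4) by (intro dvd_mod dvd_add dvd_mult)
  ultimately show False
    using assms(1) by auto
qed

lemma nonunit_prime_divisor:
  assumes "a \<in> carrier R - Units R"
  obtains q where "prime q" "q dvd m" "q dvd a"
proof -
  have "\<not> coprime a m"
  proof
    assume "coprime a m"
    with assms have "\<not> 0 < a" "0 \<le> a"
      by (auto simp: res_units_eq res_carrier_eq)
    with \<open>coprime a m\<close> m_gt_one show False by simp
  qed
  then have "\<not> is_unit (gcd a m)"
    by (simp add: coprime_iff_gcd_eq_1)
  moreover have "gcd a m \<noteq> 0"
    using m_gt_one by simp
  ultimately obtain q where "prime q" "q dvd gcd a m"
    using prime_divisor_exists by blast
  then show ?thesis
    using that by simp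
qed

lemma card_multiples:
  assumes "d > 0" "d dvd m"
  shows "card {a \<in> carrier R. d dvd a} = nat (m div d)"
proof -
  obtain c where m: "m = d * c" using assms(2) by blast
  have "{a \<in> carrier R. d dvd a} = (*) d ` {0..<c}"
    using assms(1) unfolding m
    by (auto simp: res_carrier_eq m zero_le_mult_iff elim!: dvdE)
  moreover have "inj_on ((*) d) {0..<c}"
    using assms(1) by (auto intro: inj_onI)
  ultimately show ?thesis
    using assms(1) by (simp add: card_image m)
qed

text \<open>The number \<open>r\<close> has the same prime divisors as \<open>m\<close>, so its multiples are the elements of the
  Jacobson radical.\<close>

lemma domination_poly_comaximal_graph:
  assumes "r > 1" "r dvd m"
    and primes: "\<And>q :: int. prime q \<Longrightarrow> q dvd m \<Longrightarrow> q dvd r"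
  shows "domination_poly (comaximal_graph R) =
    [:1, 1:] ^ nat m - [:1, 1:] ^ (nat m - totient (nat m))
      + [:0, 1:] ^ nat (m div r)
        * domination_poly (comaximal_graph R \<restriction> {a \<in> carrier R - Units R. \<not> r dvd a})"
proof -
  let ?J = "{a \<in> carrier R. r dvd a}"
  let ?M = "{a \<in> carrier R - Units R. \<not> r dvd a}"
  interpret G: graph "comaximal_graph R"
    by (rule graph_comaximal_graph) (rule finite)
  have V: "verts (comaximal_graph R) = carrier R"
    by (simp add: comaximal_graph_def)
  have J_nonunit: "a \<notin> Units R" if "r dvd a" for a
  proof
    assume "a \<in> Units R"
    then have "coprime a m" by (simp add: res_units_eq)
    then have "is_unit r" using that assms(2) by (rule coprime_common_divisor)
    with assms(1) show False by simp
  qed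
  have "domination_poly (comaximal_graph R) =
      [:1, 1:] ^ card (carrier R) - [:1, 1:] ^ (card (carrier R) - card (Units R))
        + [:0, 1:] ^ card ?J * domination_poly (comaximal_graph R \<restriction> ?M)"
  proof (rule G.domination_poly_universal_isolated[unfolded V])
    show "carrier R = Units R \<union> ?J \<union> ?M"
      by auto
    show "Units R \<inter> ?J = {}" "Units R \<inter> ?M = {}" "?J \<inter> ?M = {}"
      using J_nonunit by auto
    have "0 \<in> ?J" using zero_closed by (simp add: res_zero_eq)
    then show "?J \<noteq> {}" by blast
    show "u \<rightarrow>\<^bsub>comaximal_graph R\<^esub> v" if "u \<in> Units R" "v \<in> carrier R" "u \<noteq> v" for u v
      using that by (rule comaximal_graph_unit_universal)
    show "\<not> a \<rightarrow>\<^bsub>comaximal_graph R\<^esub> b" if "a \<in> ?J" "b \<in> ?J \<union> ?M" for a b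
    proof -
      have "b \<in> carrier R - Units R" using that J_nonunit by auto
      then obtain q where q: "prime q" "q dvd m" "q dvd b"
        by (rule nonunit_prime_divisor)
      moreover have "q dvd a"
        using primes[OF q(1,2)] that(1) by auto
      ultimately show ?thesis
        using comaximal_graph_common_prime by blast
    qed
  qed
  then show ?thesis
    using card_multiples[of r] assms(1,2) by (simp add: totient_eq res_carrier_eq)
qed

end

section \<open>The two formulas\<close>

theorem theorem2p3:
  fixes n :: nat
  assumes "n \<ge> 2"
  defines "R \<equiv> residue_ring (int n)"
  defines "G \<equiv> comaximal_graph R"
  shows "(\<forall>k (p :: nat \<Rightarrow> nat).
            k \<ge> 2 \<and> (\<forall>i\<in>{1..k}. prime (p i)) \<and> inj_on p {1..k} \<and> n = (\<Prod>i=1..k. p i) \<longrightarrow>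
            domination_poly G =
              [:1, 1:] ^ n - [:1, 1:] ^ (n - totient n)
                + [:0, 1:] * domination_poly (G \<restriction> (carrier R - Units R - {\<zero>\<^bsub>R\<^esub>})))
       \<and> (\<forall>k (p :: nat \<Rightarrow> nat) (e :: nat \<Rightarrow> nat).
            (\<forall>i\<in>{1..k}. prime (p i) \<and> e i > 0) \<and> inj_on p {1..k} \<and> n = (\<Prod>i=1..k. p i ^ e i) \<longrightarrow>
            domination_poly G =
              [:1, 1:] ^ n - [:1, 1:] ^ (n - totient n)
                + [:0, 1:] ^ (n div (\<Prod>i=1..k. p i))
                  * domination_poly
                      (G \<restriction> {a \<in> carrier R - Units R. \<not> int (\<Prod>i=1..k. p i) dvd a}))"
proof -
  interpret residues "int n" R
    using assms(1) by unfold_locales (simp_all add: R_def)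
  have factored: "domination_poly G =
      [:1, 1:] ^ n - [:1, 1:] ^ (n - totient n)
        + [:0, 1:] ^ (n div (\<Prod>i=1..k. p i))
          * domination_poly (G \<restriction> {a \<in> carrier R - Units R. \<not> int (\<Prod>i=1..k. p i) dvd a})"
    if pe: "\<forall>i\<in>{1..k}. prime (p i) \<and> e i > 0" and n: "n = (\<Prod>i=1..k. p i ^ e i)"
    for k and p e :: "nat \<Rightarrow> nat"
  proof -
    let ?r = "\<Prod>i=1..k. p i"
    have dvd: "?r dvd n"
      unfolding n using pe by (intro prod_dvd_prod dvd_power) auto
    have primes: "q dvd ?r" if q: "prime q" "q dvd n" for q :: nat
    proof -
      obtain i where i: "i \<in> {1..k}" "q dvd p i ^ e i"
        using q(2) unfolding n by (auto simp: prime_dvd_prod_iff[OF _ q(1)])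
      then have "q dvd p i"
        using \<open>prime q\<close> prime_dvd_power by blast
      with i(1) show ?thesis
        by (meson dvd_prod_eqI dvd_trans finite_atLeastAtMost dvd_prodI)
    qed
    have "int ?r > 1"
    proof -
      obtain q where q: "prime q" "q dvd n"
        using assms(1) prime_factor_nat[of n] by auto
      with primes[OF q] have "?r \<noteq> 1" by (metis nat_dvd_1_iff_1 not_prime_1)
      moreover have "?r \<noteq> 0"
        using dvd assms(1) by (metis dvd_0_left not_numeral_le_zero)
      ultimately show ?thesis by linarith
    qed
    moreover have "int ?r dvd int n"
      using dvd by (simp only: int_dvd_int_iff)
    moreover have "q dvd int ?r" if "prime q" "q dvd int n" for q :: int
    proof -
      have "q = int (nat q)" using prime_ge_0_int[OF that(1)] by simp
      then show ?thesis
        using that primes by (metis int_dvd_int_iff prime_nat_iff_prime prime_int_nat_transfer)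
    qed
    ultimately have "domination_poly G =
        [:1, 1:] ^ nat (int n) - [:1, 1:] ^ (nat (int n) - totient (nat (int n)))
          + [:0, 1:] ^ nat (int n div int ?r)
            * domination_poly (G \<restriction> {a \<in> carrier R - Units R. \<not> int ?r dvd a})"
      unfolding G_def by (rule domination_poly_comaximal_graph)
    then show ?thesis
      by (simp only: nat_int zdiv_int[symmetric])
  qed
  have squarefree: "domination_poly G =
      [:1, 1:] ^ n - [:1, 1:] ^ (n - totient n)
        + [:0, 1:] * domination_poly (G \<restriction> (carrier R - Units R - {\<zero>\<^bsub>R\<^esub>}))"
    if "\<forall>i\<in>{1..k}. prime (p i)" and n: "n = (\<Prod>i=1..k. p i)" for k and p :: "nat \<Rightarrow> nat"
  proof -
    have "{a \<in> carrier R - Units R. \<not> int n dvd a} = carrier R - Units R - {\<zero>\<^bsub>R\<^esub>}"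
      by (auto simp: res_zero_eq res_carrier_eq dest: zdvd_imp_le)
    moreover have "n div n = 1"
      using assms(1) by simp
    moreover have "\<forall>i\<in>{1..k}. prime (p i) \<and> (1::nat) > 0"
      using that(1) by simp
    ultimately show ?thesis
      using factored[of k p "\<lambda>_. 1", unfolded power_one_right, folded n]
      by (simp only: power_one_right)
  qed
  show ?thesis
    using factored squarefree by blast
qed

end
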